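(* Let $n \ge 0$ be an integer and let $a \geq 2$ be an integer. Then the only functions $f \in \mathscr{C}^n(\mathbb{R},\mathbb{R})$ which are solutions of the functional equation $(E_{n,a})$, i.e. which satisfy $$f(a x) = a^{n-1} \sum_{k=0}^{a-1} f\left(x + \frac{k}{a}\right) \qquad (\forall x \in \mathbb{R}),$$ are the polynomials $\lambda B_n(X)$ with $\lambda \in \mathbb{R}$.
   Context: $B_n(X)$ ($n \ge 0$) denotes the $n$-th Bernoulli polynomial, defined by the exponential generating function $\frac{t e^{Xt}}{e^t-1} = \sum_{n=0}^{+\infty} B_n(X)\frac{t^n}{n!}$. $\mathscr{C}^n(\mathbb{R},\mathbb{R})$ denotes the set of $n$ times continuously differentiable functions from $\mathbb{R}$ to $\mathbb{R}$ (continuous functions when $n=0$). *)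

theory Defs
  imports "HOL-Analysis.Analysis" "HOL-Computational_Algebra.Computational_Algebra"
begin

text \<open>
  The series \<open>t e\<^sup>X\<^sup>t / (e\<^sup>t - 1)\<close> as a formal power series in \<open>t\<close> over \<open>\<real>[X]\<close>.
  Since \<open>\<real>[X]\<close> is not a field, the quotient \<open>t / (e\<^sup>t - 1)\<close> is formed over \<open>\<real>\<close> and its
  coefficients are embedded as constant polynomials; \<open>e\<^sup>X\<^sup>t\<close> has the coefficients \<open>X\<^sup>k / k!\<close>.
\<close>

definition bernoulli_egf :: "real poly fps" where
  "bernoulli_egf =
     Abs_fps (\<lambda>k. [:fps_nth (fps_X / (fps_exp 1 - 1)) k:]) * Abs_fps (\<lambda>k. monom (1 / fact k) k)"

definition bernoulli_poly :: "nat \<Rightarrow> real poly" where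
  "bernoulli_poly n = smult (fact n) (fps_nth bernoulli_egf n)"

text \<open>Evaluating \<open>X\<close> at a real number gives back the generating function over \<open>\<real>\<close>.\<close>

lemma bernoulli_poly_egf:
  fixes x :: real
  shows "Abs_fps (\<lambda>n. poly (bernoulli_poly n) x / fact n) = fps_X * fps_exp x / (fps_exp 1 - 1)"
proof -
  have dvd: "(fps_exp 1 - 1 :: real fps) dvd fps_X"
  proof -
    have "fps_nth (fps_exp 1 - 1 :: real fps) 1 \<noteq> 0" by simp
    then have "subdegree (fps_exp 1 - 1 :: real fps) \<le> 1" 
      by (rule subdegree_leI)
    moreover have "(fps_exp 1 - 1 :: real fps) \<noteq> 0"
      using \<open>fps_nth (fps_exp 1 - 1 :: real fps) 1 \<noteq> 0\<close> by (metis fps_zero_nth)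
    ultimately show ?thesis by (simp add: fps_dvd_iff)
  qed
  have "fps_X * fps_exp x / (fps_exp 1 - 1) = fps_X / (fps_exp 1 - 1) * fps_exp x"
    using dvd by (metis dvd_div_mult)
  then show ?thesis
    by (simp add: fps_eq_iff bernoulli_poly_def bernoulli_egf_def fps_mult_nth poly_sum poly_monom)
qed

definition cont_diff :: "nat \<Rightarrow> (real \<Rightarrow> real) \<Rightarrow> bool" where
  "cont_diff n f \<longleftrightarrow>
     (\<forall>k<n. \<forall>x. (deriv ^^ k) f field_differentiable (at x)) \<and> continuous_on UNIV ((deriv ^^ n) f)"

end

theory Submission imports Defs begin

text \<open>
  That \<open>\<lambda>B\<^sub>n\<close> is a solution is Raabe's multiplication theorem, which is read off the
  generating function: summing \<open>e\<^bsup>(x+k/a)t\<^esup>\<close> over \<open>k < a\<close> turns the denominator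
  \<open>e\<^sup>t - 1\<close> into \<open>e\<^bsup>t/a\<^esup> - 1\<close>, so that only a rescaling of \<open>t\<close> by \<open>1/a\<close> is left
  (\<open>multiplication_theorem\<close>).

  Uniqueness goes by induction on \<open>n\<close>. For \<open>n = 0\<close> the equation expresses \<open>f(y)\<close> as the mean of
  the values \<open>f((y+k)/a)\<close>, \<open>k < a\<close>. Replacing \<open>y\<close> by \<open>z\<close> moves each of these points by only
  \<open>\<bar>y-z\<bar>/a\<close>, so the oscillation of \<open>f\<close> at distance \<open>\<delta>\<close> is bounded by its oscillation
  at distance \<open>\<delta>/a\<close>. Iterating and using uniform continuity on a large compact interval, which
  the maps \<open>y \<mapsto> (y+k)/a\<close> send into itself, shows that \<open>f\<close> is constant
  (\<open>averaging_solution_constant\<close>).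

  Differentiation lowers both \<open>n\<close> in the equation and, up to a factor, the index of the Bernoulli
  polynomial by one. So a solution \<open>f\<close> for \<open>n+1\<close> differs from a multiple of \<open>B\<^bsub>n+1\<^esub>\<close> by a
  constant \<open>d\<close>; by linearity \<open>d\<close> is again a solution, that is \<open>d = a\<^bsup>n+1\<^esup> d\<close>, and hence
  \<open>d = 0\<close>.
\<close>

definition raabe_equation :: "nat \<Rightarrow> nat \<Rightarrow> (real \<Rightarrow> real) \<Rightarrow> bool" where
  "raabe_equation n a f \<longleftrightarrow>
     (\<forall>x. f (real a * x) = real a powi (int n - 1) * (\<Sum>k<a. f (x + real k / real a)))"


section \<open>Bernoulli polynomials\<close>

lemma bernoulli_poly_egf_mult:
  fixes x :: real
  shows "Abs_fps (\<lambda>n. poly (bernoulli_poly n) x / fact n) * (fps_exp 1 - 1) = fps_X * fps_exp x"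
proof -
  have nz: "fps_nth (fps_exp 1 - 1 :: real fps) 1 \<noteq> 0" by simp
  then have "subdegree (fps_exp 1 - 1 :: real fps) \<le> 1" by (rule subdegree_leI)
  moreover have "(fps_exp 1 - 1 :: real fps) \<noteq> 0" using nz by (metis fps_zero_nth)
  ultimately have "(fps_exp 1 - 1 :: real fps) dvd fps_X" by (simp add: fps_dvd_iff)
  then have "(fps_exp 1 - 1 :: real fps) dvd fps_X * fps_exp x" by simp
  then show ?thesis unfolding bernoulli_poly_egf by (rule dvd_div_mult_self)
qed

lemma poly_bernoulli_poly_0: "poly (bernoulli_poly 0) x = 1"
proof -
  have "fps_nth (Abs_fps (\<lambda>n. poly (bernoulli_poly n) x / fact n) * (fps_exp 1 - 1)) 1
        = fps_nth (fps_X * fps_exp x) 1"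
    by (simp only: bernoulli_poly_egf_mult)
  then show ?thesis by (simp add: fps_mult_nth)
qed

lemma pderiv_bernoulli_poly:
  "pderiv (bernoulli_poly (Suc n)) = smult (real (Suc n)) (bernoulli_poly n)"
proof -
  define b where "b k = fps_nth (fps_X / (fps_exp 1 - 1) :: real fps) k" for k
  have coeff_B: "coeff (bernoulli_poly m) k = (if k \<le> m then fact m * b (m - k) / fact k else 0)"
    for m k
  proof -
    have "coeff (bernoulli_poly m) k
          = fact m * (\<Sum>i\<le>m. b i * (if m - i = k then 1 / fact (m - i) else 0))"
      by (simp add: bernoulli_poly_def bernoulli_egf_def fps_mult_nth b_def atLeast0AtMost coeff_sum)
    also have "(\<Sum>i\<le>m. b i * (if m - i = k then 1 / fact (m - i) else 0))
               = (\<Sum>i\<le>m. if i = m - k \<and> k \<le> m then b i / fact k else 0)"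
      by (intro sum.cong) auto
    finally show ?thesis by simp
  qed
  show ?thesis
    by (rule poly_eqI) (simp add: coeff_pderiv coeff_B fact_Suc del: of_nat_Suc)
qed

text \<open>
  With \<open>q = e\<^bsup>t/a\<^esup>\<close> the geometric sum \<open>1 + q + \<dots> + q\<^bsup>a-1\<^esup> = (e\<^sup>t - 1)/(q - 1)\<close> identifies the
  generating function of the sum with \<open>t e\<^bsup>xt\<^esup>/(q - 1)\<close>, which is \<open>a\<close> times the generating
  function at \<open>ax\<close> in the variable \<open>t/a\<close>.
\<close>

lemma multiplication_theorem:
  assumes "a > 0"
  shows "raabe_equation n a (poly (bernoulli_poly n))"
  unfolding raabe_equation_def
proof
  fix x :: real
  define r where "r = 1 / real a"
  have r: "r \<noteq> 0" "real a * r = 1" using assms by (auto simp: r_def)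
  define G where "G y = Abs_fps (\<lambda>n. poly (bernoulli_poly n) y / fact n)" for y :: real
  define q where "q = fps_exp r"
  define S where "S = (\<Sum>k<a. G (x + real k / real a))"
  define H where "H = fps_compose (G (real a * x)) (fps_const r * fps_X)"
  have q_power: "q ^ k = fps_exp (real k / real a)" for k
    by (simp add: q_def r_def fps_exp_power_mult)
  have q_nz: "q - 1 \<noteq> 0"
  proof
    assume "q - 1 = 0"
    then have "fps_nth (q - 1) 1 = 0" by simp
    then show False using r by (simp add: q_def)
  qed
  have e_nz: "fps_exp 1 - 1 \<noteq> (0 :: real fps)"
  proof
    assume "fps_exp 1 - 1 = (0 :: real fps)"
    then have "fps_nth (fps_exp 1 - 1 :: real fps) 1 = 0" by simp
    then show False by simp
  qed
  have "S * (fps_exp 1 - 1) = (\<Sum>k<a. fps_X * fps_exp x * q ^ k)"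
    by (simp add: S_def sum_distrib_right G_def bernoulli_poly_egf_mult q_power fps_exp_add_mult
                  mult.assoc)
  also have "\<dots> = fps_X * fps_exp x * (\<Sum>k<a. q ^ k)" by (simp add: sum_distrib_left)
  finally have "S * (fps_exp 1 - 1) * (q - 1) = fps_X * fps_exp x * ((q - 1) * (\<Sum>k<a. q ^ k))"
    by (simp add: mult_ac)
  also have "(q - 1) * (\<Sum>k<a. q ^ k) = fps_exp 1 - 1"
    using power_diff_1_eq [of q a] assms by (simp add: q_power)
  finally have "(S * (q - 1)) * (fps_exp 1 - 1) = (fps_X * fps_exp x) * (fps_exp 1 - 1)"
    by (simp add: mult_ac)
  then have S: "S * (q - 1) = fps_X * fps_exp x"
    using e_nz by simp
  have "H * (q - 1) = fps_compose (G (real a * x) * (fps_exp 1 - 1)) (fps_const r * fps_X)"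
    by (simp add: H_def q_def fps_compose_mult_distrib fps_compose_sub_distrib)
  also have "\<dots> = fps_const r * fps_X * fps_exp x"
    using r(2) by (simp add: G_def bernoulli_poly_egf_mult fps_compose_mult_distrib r_def)
  finally have "(fps_const (real a) * H) * (q - 1) = fps_const (real a * r) * fps_X * fps_exp x"
    by (simp add: mult.assoc flip: fps_const_mult)
  then have "(fps_const (real a) * H) * (q - 1) = S * (q - 1)"
    using r S by simp
  then have "S = fps_const (real a) * H" using q_nz by simp
  then have "fps_nth S n = real a * r ^ n * fps_nth (G (real a * x)) n"
    by (simp add: H_def fps_compose_linear)
  then have "(\<Sum>k<a. poly (bernoulli_poly n) (x + real k / real a))
             = real a * r ^ n * poly (bernoulli_poly n) (real a * x)"
    by (simp add: S_def G_def fps_sum_nth flip: sum_divide_distrib)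
  then show "poly (bernoulli_poly n) (real a * x) = real a powi (int n - 1) *
        (\<Sum>k<a. poly (bernoulli_poly n) (x + real k / real a))"
    using assms by (simp add: r_def power_int_diff field_simps)
qed


section \<open>Operations on solutions\<close>

lemma raabe_equation_cmult:
  "raabe_equation n a f \<Longrightarrow> raabe_equation n a (\<lambda>x. c * f x)"
  by (simp add: raabe_equation_def sum_distrib_left [symmetric])

lemma raabe_equation_diff:
  "raabe_equation n a f \<Longrightarrow> raabe_equation n a g \<Longrightarrow> raabe_equation n a (\<lambda>x. f x - g x)"
  by (simp add: raabe_equation_def sum_subtractf right_diff_distrib)

lemma raabe_equation_constant_eq_0:
  assumes "raabe_equation (Suc n) a (\<lambda>_. d)" "a \<ge> 2"
  shows "d = 0"
proof -
  have "d = real a ^ n * (real a * d)"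
    using assms(1) by (simp add: raabe_equation_def)
  then have "d * (real a ^ Suc n - 1) = 0" by (simp add: algebra_simps)
  moreover have "real a ^ Suc n > 1" using assms(2) by (intro one_less_power) auto
  ultimately show ?thesis by simp
qed

text \<open>
  The chain rule puts a factor \<open>a\<close> on the left; cancelling it lowers the exponent in \<open>a\<^sup>n\<close>.
\<close>

lemma raabe_equation_deriv:
  assumes f: "raabe_equation (Suc n) a f" and diff: "\<And>x. f field_differentiable (at x)" and "a > 0"
  shows "raabe_equation n a (deriv f)"
  unfolding raabe_equation_def
proof
  fix x :: real
  have D: "(f has_field_derivative deriv f y) (at y)" for y
    using diff by (simp add: field_differentiable_derivI)
  have "((\<lambda>x. f (real a * x)) has_field_derivative deriv f (real a * x) * real a) (at x)"
    by (rule DERIV_chain2 [OF D]) (auto intro!: derivative_eq_intros)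
  moreover have "((\<lambda>x. real a ^ n * (\<Sum>k<a. f (x + real k / real a)))
      has_field_derivative real a ^ n * (\<Sum>k<a. deriv f (x + real k / real a))) (at x)"
    by (intro DERIV_cmult DERIV_sum) (simp add: D flip: DERIV_shift)
  moreover have "(\<lambda>x. f (real a * x)) = (\<lambda>x. real a ^ n * (\<Sum>k<a. f (x + real k / real a)))"
    using f by (simp add: raabe_equation_def)
  ultimately have "deriv f (real a * x) * real a
                   = real a ^ n * (\<Sum>k<a. deriv f (x + real k / real a))"
    by (metis DERIV_unique)
  then show "deriv f (real a * x)
             = real a powi (int n - 1) * (\<Sum>k<a. deriv f (x + real k / real a))"
    using \<open>a > 0\<close> by (simp add: power_int_diff field_simps)
qed


section \<open>The continuous solutions for index zero\<close>

text \<open>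
  A scale \<open>\<delta>\<close> at which \<open>f\<close> oscillates by at most \<open>\<epsilon>\<close> can be enlarged to \<open>a\<delta>\<close>, because
  \<open>f(y) - f(z)\<close> is the mean of differences of \<open>f\<close> at points \<open>\<bar>y-z\<bar>/a\<close> apart. The condition
  \<open>M \<ge> 1\<close> keeps those points in the interval: \<open>(M + a - 1)/a \<le> M\<close>.
\<close>

lemma raabe_equation_0_oscillation_step:
  assumes f: "raabe_equation 0 a f" and "a > 0" and M: "M \<ge> 1"
    and small: "\<And>y z. y \<in> {-M..M} \<Longrightarrow> z \<in> {-M..M} \<Longrightarrow> \<bar>y - z\<bar> \<le> \<delta> \<Longrightarrow> \<bar>f y - f z\<bar> \<le> \<epsilon>"
    and yz: "y \<in> {-M..M}" "z \<in> {-M..M}" "\<bar>y - z\<bar> \<le> real a * \<delta>"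
  shows "\<bar>f y - f z\<bar> \<le> \<epsilon>"
proof -
  have a: "real a \<ge> 1" using \<open>a > 0\<close> by simp
  have mean: "real a * f u = (\<Sum>k<a. f (u / real a + real k / real a))" for u
    using f [unfolded raabe_equation_def, rule_format, of "u / real a"] a
    by (simp add: field_simps power_int_minus)
  have inside: "u / real a + real k / real a \<in> {-M..M}" if "u \<in> {-M..M}" "k < a" for u k
  proof -
    have k: "0 \<le> real k" "real k \<le> real a - 1" using that(2) by linarith+
    have "0 \<le> (M - 1) * (real a - 1)" using M a by simp
    then have le: "M + (real a - 1) \<le> M * real a" by (simp add: algebra_simps)
    have "u + real k \<le> M * real a" "- (M * real a) \<le> u + real k"
      using that(1) k le a by auto
    then show ?thesis using a by (simp add: field_simps)
  qed
  have "real a * \<bar>f y - f z\<bar> = \<bar>real a * f y - real a * f z\<bar>"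
    by (simp add: abs_mult flip: right_diff_distrib)
  also have "\<dots> = \<bar>\<Sum>k<a. f (y / real a + real k / real a) - f (z / real a + real k / real a)\<bar>"
    by (simp add: mean sum_subtractf)
  also have "\<dots> \<le> (\<Sum>k<a. \<epsilon>)"
  proof (rule order_trans [OF sum_abs sum_mono], rule small)
    fix k assume "k \<in> {..<a}"
    then show "y / real a + real k / real a \<in> {-M..M}" "z / real a + real k / real a \<in> {-M..M}"
      using inside yz by auto
    have "y / real a + real k / real a - (z / real a + real k / real a) = (y - z) / real a"
      by (simp add: diff_divide_distrib)
    then show "\<bar>y / real a + real k / real a - (z / real a + real k / real a)\<bar> \<le> \<delta>"
      using yz(3) a by (simp add: abs_divide pos_divide_le_eq mult.commute)
  qed
  finally show ?thesis using a by simp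
qed

text \<open>
  Uniform continuity supplies a first scale \<open>\<delta>\<close> for any given \<open>\<epsilon>\<close>; the scales \<open>a\<^sup>m \<delta>\<close>
  eventually exceed the distance of any two given points.
\<close>

lemma averaging_solution_constant:
  assumes f: "raabe_equation 0 a f" and a: "a \<ge> 2" and cont: "continuous_on UNIV f"
  shows "f y = f z"
proof -
  define M where "M = max 1 (max \<bar>y\<bar> \<bar>z\<bar>)"
  have M: "M \<ge> 1" and yz: "y \<in> {-M..M}" "z \<in> {-M..M}" by (auto simp: M_def)
  have "uniformly_continuous_on {-M..M} f"
    using cont by (intro compact_uniformly_continuous) (auto intro: continuous_on_subset)
  then have "\<bar>f y - f z\<bar> \<le> \<epsilon>" if "\<epsilon> > 0" for \<epsilon>
  proof -
    obtain d where "d > 0"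
      and d: "\<And>u v. u \<in> {-M..M} \<Longrightarrow> v \<in> {-M..M} \<Longrightarrow> dist v u < d \<Longrightarrow> dist (f v) (f u) < \<epsilon>"
      using \<open>uniformly_continuous_on {-M..M} f\<close> \<open>\<epsilon> > 0\<close>
      unfolding uniformly_continuous_on_def by metis
    \<comment> \<open>half of \<open>d\<close>, since the modulus of continuity is stated with a strict inequality\<close>
    have scaled: "\<bar>f u - f v\<bar> \<le> \<epsilon>"
      if "u \<in> {-M..M}" "v \<in> {-M..M}" "\<bar>u - v\<bar> \<le> real a ^ m * (d / 2)" for u v m
      using that
    proof (induction m arbitrary: u v)
      case 0
      then show ?case using d [of v u] \<open>d > 0\<close> by (force simp: dist_real_def)
    next
      case (Suc m)
      show ?case
        by (rule raabe_equation_0_oscillation_step [where \<delta> = "real a ^ m * (d / 2)"])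
           (use f a M Suc in \<open>auto simp: mult_ac\<close>)
    qed
    obtain m where "\<bar>y - z\<bar> / (d / 2) < real a ^ m"
      using real_arch_pow [of "real a"] a by auto
    then have "\<bar>y - z\<bar> \<le> real a ^ m * (d / 2)" using \<open>d > 0\<close> by (simp add: field_simps)
    then show ?thesis by (rule scaled [OF yz])
  qed
  then have "\<bar>f y - f z\<bar> \<le> 0" using dense_ge by blast
  then show ?thesis by simp
qed


section \<open>Classification of the solutions\<close>

lemma cont_diff_poly: "cont_diff n (poly p)"
proof -
  have "deriv (poly q) = poly (pderiv q)" for q :: "real poly"
    by (intro ext DERIV_imp_deriv poly_DERIV)
  then have "(deriv ^^ k) (poly p) = poly ((pderiv ^^ k) p)" for k
    by (induction k) auto
  moreover have "poly q field_differentiable (at x)" for q :: "real poly" and x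
    using poly_DERIV field_differentiable_def by blast
  ultimately show ?thesis
    by (auto simp: cont_diff_def intro!: continuous_intros)
qed

lemma cont_diff_Suc_iff:
  "cont_diff (Suc n) f \<longleftrightarrow> (\<forall>x. f field_differentiable (at x)) \<and> cont_diff n (deriv f)"
  by (simp add: cont_diff_def All_less_Suc2 funpow_Suc_right del: funpow.simps)

lemma raabe_equation_imp_bernoulli:
  assumes "a \<ge> 2" "cont_diff n f" "raabe_equation n a f"
  shows "\<exists>c. f = poly (smult c (bernoulli_poly n))"
  using assms(2,3)
proof (induction n arbitrary: f)
  case 0
  then have "continuous_on UNIV f" by (simp add: cont_diff_def)
  then have "f x = f 0" for x
    using averaging_solution_constant 0 \<open>a \<ge> 2\<close> by blast
  then have "f = poly (smult (f 0) (bernoulli_poly 0))"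
    by (auto simp: poly_bernoulli_poly_0)
  then show ?case ..
next
  case (Suc n)
  have diff: "\<And>x. f field_differentiable (at x)" and "cont_diff n (deriv f)"
    using Suc.prems by (auto simp: cont_diff_Suc_iff)
  moreover have "raabe_equation n a (deriv f)"
    using Suc.prems diff \<open>a \<ge> 2\<close> by (intro raabe_equation_deriv) auto
  ultimately obtain c where c: "deriv f = poly (smult c (bernoulli_poly n))"
    using Suc.IH by blast
  define b where "b = c / real (Suc n)"
  define g where "g x = f x - b * poly (bernoulli_poly (Suc n)) x" for x
  have "(g has_field_derivative 0) (at x)" for x
  proof -
    have "(f has_field_derivative deriv f x) (at x)"
      using diff by (simp add: field_differentiable_derivI)
    then have "(g has_field_derivative
        deriv f x - b * poly (pderiv (bernoulli_poly (Suc n))) x) (at x)"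
      unfolding g_def by (intro DERIV_diff DERIV_cmult poly_DERIV)
    moreover have "deriv f x = b * poly (pderiv (bernoulli_poly (Suc n))) x"
      by (simp add: c b_def pderiv_bernoulli_poly del: of_nat_Suc)
    ultimately show ?thesis by simp
  qed
  then have const: "g = (\<lambda>_. g 0)"
    using DERIV_isconst_all by blast
  have "raabe_equation (Suc n) a g"
    unfolding g_def using Suc.prems \<open>a \<ge> 2\<close>
    by (intro raabe_equation_diff raabe_equation_cmult multiplication_theorem) auto
  then have "raabe_equation (Suc n) a (\<lambda>_. g 0)" using const by simp
  then have "g 0 = 0" using \<open>a \<ge> 2\<close> by (rule raabe_equation_constant_eq_0)
  then have "g x = 0" for x using const by metis
  then have "f = poly (smult b (bernoulli_poly (Suc n)))"
    by (auto simp: g_def)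
  then show ?case ..
qed

theorem corollary3p5:
  fixes n a :: nat and f :: "real \<Rightarrow> real"
  assumes "a \<ge> 2"
  shows "(cont_diff n f \<and>
            (\<forall>x. f (real a * x) = real a powi (int n - 1) * (\<Sum>k = 0..a - 1. f (x + real k / real a))))
         \<longleftrightarrow> (\<exists>c. f = poly (smult c (bernoulli_poly n)))"
proof -
  have "{0..a - 1} = {..<a}" using assms by auto
  then have eq: "(\<forall>x. f (real a * x) = real a powi (int n - 1) * (\<Sum>k = 0..a - 1. f (x + real k / real a)))
                 \<longleftrightarrow> raabe_equation n a f"
    by (simp add: raabe_equation_def)
  have "raabe_equation n a (poly (smult c (bernoulli_poly n)))" for c
    using raabe_equation_cmult [OF multiplication_theorem, of a n c] assms
    by (simp add: raabe_equation_def)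
  then show ?thesis
    unfolding eq using raabe_equation_imp_bernoulli [OF assms] cont_diff_poly by blast
qed

end
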